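(* Let $M=pq$ be a product of two distinct primes with $p<q$, and let $\mathcal{A},\mathcal{B}\subset\{0,1,\dots,M-1\}$ with $1<|\mathcal{A}|=|\mathcal{B}|<M$. If $(\mathcal{A},\mathcal{B})$ is a distributed spectral pair in $\mathbb{Z}_M$, then $(\mathcal{A},\mathcal{B})$ is a spectral pair in $\mathbb{Z}_M$.
   Context: For a nonempty finite set $E\subset\mathbb{R}$, put $\widehat{\nu_E}(\xi)=\frac{1}{|E|}\sum_{a\in E}e^{-2\pi i\xi a}$ for $\xi\in\mathbb{R}$. Spectral pair: $(\mathcal{A},\mathcal{B})$ with $|\mathcal{A}|=|\mathcal{B}|$ is a spectral pair in $\mathbb{Z}_M$ if the matrix $\frac{1}{\sqrt{|\mathcal{A}|}}\left(e^{2\pi i ab/M}\right)_{a\in\mathcal{A},b\in\mathcal{B}}$ is unitary. Distributed spectral pair: $(\mathcal{A},\mathcal{B})$ with $|\mathcal{A}|=|\mathcal{B}|$ is a distributed spectral pair in $\mathbb{Z}_M$ if for all $b_1\neq b_1'$ in $\mathcal{B}$, either $\widehat{\nu_{\mathcal{A}}}\left(\frac{b_1-b_1'}{M}\right)=0$, or $\widehat{\nu_{\mathcal{A}}}\left(\frac{b_1-b_1'}{M^2}+\frac{b_2-b_2'}{M}\right)=0$ for all $b_2,b_2'\in\mathcal{B}$. *)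

theory Defs
  imports
    Complex_Main
    "HOL-Computational_Algebra.Primes"
    "Jordan_Normal_Form.Schur_Decomposition"
begin

definition nu_hat :: "real set \<Rightarrow> real \<Rightarrow> complex" where
  "nu_hat E \<xi> = 1 / of_nat (card E) *
     (\<Sum>a\<in>E. exp (- 2 * of_real pi * \<i> * of_real \<xi> * of_real a))"

definition unitary_mat :: "complex mat \<Rightarrow> bool" where
  "unitary_mat U \<longleftrightarrow>
     square_mat U \<and> inverts_mat U (mat_adjoint U) \<and> inverts_mat (mat_adjoint U) U"

text \<open>Rows are indexed by A and columns by B, each listed in increasing order; another
  order permutes rows and columns and does not affect unitarity.\<close>

definition spectral_matrix :: "nat \<Rightarrow> nat set \<Rightarrow> nat set \<Rightarrow> complex mat" where
  "spectral_matrix M A B = mat (card A) (card B) (\<lambda>(i, j).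
     1 / of_real (sqrt (real (card A))) *
       exp (2 * of_real pi * \<i> * of_nat (sorted_list_of_set A ! i)
              * of_nat (sorted_list_of_set B ! j) / of_nat M))"

text \<open>Subsets of \<open>\<int>\<^sub>M\<close> are given by their representatives in \<open>{0, \<dots>, M - 1}\<close>. The choice of
  representatives matters for distributed spectral pairs, because of the denominator \<open>M^2\<close>.\<close>

definition spectral_pair :: "nat \<Rightarrow> nat set \<Rightarrow> nat set \<Rightarrow> bool" where
  "spectral_pair M A B \<longleftrightarrow>
     A \<subseteq> {..<M} \<and> B \<subseteq> {..<M} \<and> card A = card B \<and> unitary_mat (spectral_matrix M A B)"

definition distributed_spectral_pair :: "nat \<Rightarrow> nat set \<Rightarrow> nat set \<Rightarrow> bool" where
  "distributed_spectral_pair M A B \<longleftrightarrow>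
     A \<subseteq> {..<M} \<and> B \<subseteq> {..<M} \<and> card A = card B \<and>
     (\<forall>b1\<in>B. \<forall>b1'\<in>B. b1 \<noteq> b1' \<longrightarrow>
        nu_hat (real ` A) ((real b1 - real b1') / real M) = 0 \<or>
        (\<forall>b2\<in>B. \<forall>b2'\<in>B.
           nu_hat (real ` A)
             ((real b1 - real b1') / (real M)\<^sup>2 + (real b2 - real b2') / real M) = 0))"

end

theory Submission
  imports Defs "HOL-Number_Theory.Totient"
begin

text \<open>
  The second alternative in the definition of a distributed spectral pair never occurs for
  \<open>M = p q\<close>. It would hold in particular for \<open>b\<^sub>2 = b\<^sub>2'\<close>, so the polynomial
  \<open>A(X) = \<Sum>a\<in>A. X ^ a\<close> would vanish at \<open>z = exp (- 2 \<pi> i d / M\<^sup>2)\<close> for some integer \<open>d\<close> with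
  \<open>0 < \<bar>d\<bar> < M\<close>. The lemma \<open>nu_hat_nonzero\<close> excludes this. Only the first alternative is then
  left, which says that distinct columns of the spectral matrix are orthogonal.

  Why \<open>A(z) \<noteq> 0\<close>: the multiplicative order \<open>n\<close> of \<open>z\<close> divides \<open>M\<^sup>2\<close>, and \<open>n > M\<close> because
  \<open>z ^ m = 1\<close> means that \<open>M\<^sup>2\<close> divides \<open>m d\<close>, while \<open>\<bar>d\<bar> < M\<close>. A nonzero integer polynomial that
  vanishes at a root of unity of order \<open>n\<close> vanishes at all its conjugates \<open>z ^ k\<close> with \<open>k\<close> coprime to \<open>n\<close>
  (\<open>ipoly_at_conjugate_root_of_unity\<close>), hence has degree at least \<open>totient n\<close>. The divisors
  \<open>n > p q\<close> of \<open>p\<^sup>2 q\<^sup>2\<close> are \<open>q\<^sup>2\<close>, \<open>p\<^sup>2 q\<close>, \<open>p q\<^sup>2\<close> and \<open>p\<^sup>2 q\<^sup>2\<close>, and \<open>totient n \<ge> p q\<close> for all of them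
  unless \<open>p = 2\<close> and \<open>n = 4 q\<close>. Since \<open>A(X)\<close> has degree less than \<open>p q\<close>, only this case remains.
  There \<open>A(X)\<close> is the \<open>4 q\<close>-th cyclotomic polynomial \<open>1 - X\<^sup>2 + X\<^sup>4 - \<dots> + X ^ (2 q - 2)\<close> times a
  linear factor, so that its even coefficients alternate in sign, and so do its odd ones. As the
  coefficients are \<open>0\<close> or \<open>1\<close>, all of them vanish (\<open>nonneg_poly_at_primitive_root_4q_eq_0\<close>), but
  \<open>A\<close> is not empty.

  The invariance under conjugation is the irreducibility of cyclotomic polynomials in disguise. It
  is proved after Landau: for a prime \<open>r\<close>, \<open>f(X ^ r)\<close> and \<open>f(X) ^ r\<close> agree modulo \<open>r\<close>, so
  \<open>f(z) = 0\<close> makes \<open>f(z ^ r)\<close> divisible by \<open>r\<close> in the ring generated by \<open>z\<close> over the integers.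
  A nonzero element of this ring has only finitely many prime divisors, and \<open>f(z ^ r)\<close> takes only
  finitely many values; hence \<open>f(z ^ r) = 0\<close> for all but finitely many primes \<open>r\<close>. Every residue
  class coprime to \<open>n\<close> contains a product of primes that are not among the exceptional ones.
\<close>

section \<open>The Frobenius map on integer polynomials\<close>

lemma prime_dvd_power_add_diff:
  fixes a b :: "'a :: comm_ring_1"
  assumes "prime r"
  shows "of_nat r dvd (a + b) ^ r - a ^ r - b ^ r"
proof -
  have r: "r > 0" using assms by (simp add: prime_gt_0_nat)
  have "(a + b) ^ r = (\<Sum>k\<le>r. of_nat (r choose k) * a ^ k * b ^ (r - k))"
    by (rule binomial_ring)
  also have "{..r} = insert 0 (insert r {0<..<r})" using r by auto
  also have "(\<Sum>k\<in>\<dots>. of_nat (r choose k) * a ^ k * b ^ (r - k)) =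
      a ^ r + b ^ r + (\<Sum>k\<in>{0<..<r}. of_nat (r choose k) * a ^ k * b ^ (r - k))"
    using r by (simp add: algebra_simps)
  finally have "(a + b) ^ r - a ^ r - b ^ r =
      (\<Sum>k\<in>{0<..<r}. of_nat (r choose k) * a ^ k * b ^ (r - k))"
    by simp
  also have "of_nat r dvd \<dots>"
  proof (intro dvd_sum dvd_mult2)
    fix k assume "k \<in> {0<..<r}"
    hence "r dvd (r choose k)" using assms by (intro dvd_choose_prime) auto
    thus "of_nat r dvd (of_nat (r choose k) :: 'a)" by (metis dvd_def of_nat_mult)
  qed
  finally show ?thesis .
qed

lemma prime_dvd_int_power_minus_self:
  fixes a :: int
  assumes "prime r"
  shows "int r dvd a ^ r - a"
proof (induction a rule: int_induct[of _ 0])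
  case base
  show ?case using assms by (auto simp: power_0_left)
next
  case (step1 i)
  have "(i + 1) ^ r - (i + 1) = ((i + 1) ^ r - i ^ r - 1 ^ r) + (i ^ r - i)" by simp
  thus ?case using step1 prime_dvd_power_add_diff[OF assms, of i 1] by (metis dvd_add)
next
  case (step2 i)
  have "(i - 1) ^ r - (i - 1) = (i ^ r - i) - ((i - 1 + 1) ^ r - (i - 1) ^ r - 1 ^ r)" by simp
  thus ?case using step2 prime_dvd_power_add_diff[OF assms, of "i - 1" 1] by (metis dvd_diff)
qed

text \<open>
  The Frobenius map modulo \<open>r\<close>. Arithmetic in characteristic \<open>r\<close> is replaced by divisibility by
  \<open>r\<close>, because the quotient will be evaluated at complex numbers.
\<close>

lemma prime_dvd_pcompose_monom_minus_power:
  fixes f :: "int poly"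
  assumes "prime r"
  shows "of_nat r dvd pcompose f (monom 1 r) - f ^ r"
proof (induction f)
  case 0
  show ?case using assms by (auto simp: power_0_left)
next
  case (pCons a g)
  let ?X = "[:0, 1:] :: int poly"
  have m: "monom 1 r = ?X ^ r" by (simp add: monom_altdef)
  have split: "pCons a g = [:a:] + ?X * g" by simp
  have 1: "of_nat r dvd (pCons a g) ^ r - [:a:] ^ r - (?X * g) ^ r"
    unfolding split by (rule prime_dvd_power_add_diff[OF assms])
  have "int r dvd a ^ r - a" by (rule prime_dvd_int_power_minus_self[OF assms])
  hence "[:int r:] dvd [:a ^ r - a:]" by (auto simp: dvd_def intro: exI[of _ "[:_:]"])
  hence 2: "of_nat r dvd [:a:] ^ r - [:a:]" by (simp add: of_nat_poly poly_const_pow)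
  have 3: "of_nat r dvd ?X ^ r * (pcompose g (monom 1 r) - g ^ r)"
    using pCons.IH by (rule dvd_mult)
  have "pcompose (pCons a g) (monom 1 r) - pCons a g ^ r =
     ?X ^ r * (pcompose g (monom 1 r) - g ^ r) - ([:a:] ^ r - [:a:])
     - (pCons a g ^ r - [:a:] ^ r - (?X * g) ^ r)"
    unfolding power_mult_distrib by (simp add: pcompose_pCons m right_diff_distrib)
  thus ?case using 1 2 3 by (metis dvd_diff)
qed

section \<open>Divisibility by primes in the ring generated by a root of unity\<close>

abbreviation ipoly_at :: "int poly \<Rightarrow> complex \<Rightarrow> complex" where
  "ipoly_at f z \<equiv> poly (of_int_poly f) z"

lemma power_mod_of_root_of_unity:
  fixes z :: complex
  assumes "z ^ n = 1"
  shows "z ^ i = z ^ (i mod n)"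
proof -
  have "z ^ i = z ^ (n * (i div n) + i mod n)" by simp
  also have "\<dots> = z ^ (i mod n)" unfolding power_add power_mult using assms by simp
  finally show ?thesis .
qed

text \<open>
  The elements \<open>ipoly_at g z\<close> form the ring generated by \<open>z\<close> over the integers, which is therefore
  finitely generated as an additive group.
\<close>

lemma ipoly_at_sum_below:
  assumes "z ^ n = 1" "n > 0"
  shows "\<exists>c. ipoly_at g z = (\<Sum>j<n. of_int (c j) * z ^ j)"
proof -
  let ?D = "{..degree g}"
  have "ipoly_at g z = (\<Sum>i\<in>?D. of_int (coeff g i) * z ^ (i mod n))"
    by (simp add: poly_altdef power_mod_of_root_of_unity[OF assms(1), symmetric])
  also have "\<dots> = (\<Sum>j<n. \<Sum>i\<in>{i\<in>?D. i mod n = j}. of_int (coeff g i) * z ^ (i mod n))"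
    using assms by (intro sum.group[symmetric]) auto
  also have "\<dots> = (\<Sum>j<n. of_int (\<Sum>i\<in>{i\<in>?D. i mod n = j}. coeff g i) * z ^ j)"
    by (intro sum.cong refl) (simp add: sum_distrib_right)
  finally show ?thesis by (intro exI[of _ "\<lambda>j. \<Sum>i\<in>{i\<in>?D. i mod n = j}. coeff g i"])
qed

text \<open>
  Multiplication by \<open>x = ipoly_at g z\<close> maps each \<open>z ^ i\<close> to an integral combination of
  \<open>1, z, \<dots>, z ^ (n - 1)\<close>. So \<open>x\<close> is an eigenvalue of an integer matrix, and the characteristic
  polynomial of that matrix is monic with integer coefficients.
\<close>

lemma algebraic_int_ipoly_at_root_of_unity:
  assumes z: "z ^ n = 1" and n: "n > 0"
  shows "algebraic_int (ipoly_at g z)"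
proof -
  have "\<forall>i. \<exists>c. ipoly_at (g * monom 1 i) z = (\<Sum>j<n. of_int (c j) * z ^ j)"
    using ipoly_at_sum_below[OF z n] by blast
  then obtain c where c: "ipoly_at (g * monom 1 i) z = (\<Sum>j<n. of_int (c i j) * z ^ j)" for i
    by metis
  have c': "ipoly_at g z * z ^ i = (\<Sum>j<n. of_int (c i j) * z ^ j)" for i
    using c[of i] by (simp add: of_int_poly_hom.hom_mult poly_monom)
  define C :: "int mat" where "C = mat n n (\<lambda>(i, j). c i j)"
  define C' :: "complex mat" where "C' = map_mat of_int C"
  have C: "C \<in> carrier_mat n n" and C': "C' \<in> carrier_mat n n" by (auto simp: C_def C'_def)
  define v where "v = vec n (\<lambda>j. z ^ j)"
  have v0: "v \<noteq> 0\<^sub>v n"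
  proof
    assume "v = 0\<^sub>v n"
    hence "v $ 0 = 0" using n by simp
    thus False using n by (simp add: v_def)
  qed
  have "C' *\<^sub>v v = ipoly_at g z \<cdot>\<^sub>v v"
  proof (intro eq_vecI)
    fix i assume "i < dim_vec (ipoly_at g z \<cdot>\<^sub>v v)"
    hence i: "i < n" by (simp add: v_def)
    show "(C' *\<^sub>v v) $ i = (ipoly_at g z \<cdot>\<^sub>v v) $ i"
      using i by (simp add: C'_def C_def v_def scalar_prod_def c' atLeast0LessThan)
  qed (simp add: v_def C'_def C_def)
  hence "eigenvector C' v (ipoly_at g z)" using v0 C' by (simp add: eigenvector_def v_def)
  hence "poly (char_poly C') (ipoly_at g z) = 0"
    using eigenvalue_root_char_poly[OF C'] by (auto simp: eigenvalue_def)
  hence "poly (of_int_poly (char_poly C)) (ipoly_at g z) = 0"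
    unfolding C'_def of_int_hom.char_poly_hom[OF C] .
  moreover have "lead_coeff (char_poly C) = 1"
    using degree_monic_char_poly[OF C] by simp
  ultimately show ?thesis unfolding algebraic_int_altdef_ipoly by blast
qed

text \<open>
  As \<open>x \<noteq> 0\<close>, factors \<open>X\<close> of \<open>P\<close> can be cancelled without losing the root \<open>x\<close>.
\<close>

lemma algebraic_nonzero_const_coeff:
  assumes "P \<noteq> 0" "ipoly_at P x = 0" "x \<noteq> 0"
  shows "\<exists>Q. ipoly_at Q x = 0 \<and> coeff Q 0 \<noteq> 0"
  using assms
proof (induction P)
  case (pCons a P)
  show ?case
  proof (cases "a = 0")
    case True
    thus ?thesis using pCons by auto
  next
    case False
    thus ?thesis using pCons.prems by (intro exI[of _ "pCons a P"]) auto
  qed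
qed auto

text \<open>
  If \<open>a + x R(x) = 0\<close> with integers \<open>a \<noteq> 0\<close> and coefficients of \<open>R\<close>, then a prime \<open>r\<close> that divides
  \<open>x\<close> in the ring generated by \<open>z\<close> also divides \<open>a\<close> in this ring. The quotient \<open>a / r\<close> is then
  a rational algebraic integer, thus an integer, so \<open>r\<close> is one of the finitely many prime divisors
  of \<open>a\<close>.
\<close>

lemma finite_prime_divisors_cyclotomic_integer:
  assumes z: "z ^ n = 1" and n: "n > 0" and x: "ipoly_at g z \<noteq> 0"
  shows "\<exists>N>0. \<forall>r h. prime r \<longrightarrow> ipoly_at g z = of_nat r * ipoly_at h z \<longrightarrow> r dvd (N :: nat)"
proof -
  let ?x = "ipoly_at g z"
  have "algebraic_int ?x" by (rule algebraic_int_ipoly_at_root_of_unity[OF z n])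
  then obtain P where "ipoly_at P ?x = 0" "lead_coeff P = 1"
    unfolding algebraic_int_altdef_ipoly by blast
  hence "P \<noteq> 0" by auto
  from algebraic_nonzero_const_coeff[OF this \<open>ipoly_at P ?x = 0\<close> x]
  obtain Q where Q: "ipoly_at Q ?x = 0" "coeff Q 0 \<noteq> 0" by blast
  obtain a R where aR: "Q = pCons a R" by (cases Q)
  have a0: "a \<noteq> 0" using Q aR by simp
  have "r dvd nat \<bar>a\<bar>" if r: "prime r" and h: "?x = of_nat r * ipoly_at h z" for r h
  proof -
    define S where "S = - (h * pcompose R g)"
    have "of_int a = - (?x * ipoly_at R ?x)" using Q(1) aR
      by (simp add: eq_neg_iff_add_eq_0 of_int_hom.map_poly_pCons_hom)
    also have "\<dots> = of_nat r * ipoly_at S z"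
      unfolding S_def by (subst (1) h)
        (simp add: of_int_poly_hom.hom_mult of_int_poly_hom.hom_uminus of_int_hom.map_poly_pcompose poly_pcompose)
    finally have eq: "of_int a = of_nat r * ipoly_at S z" .
    have r0: "r > 0" using r by (simp add: prime_gt_0_nat)
    have "ipoly_at S z = of_int a / of_nat r" using eq r0 by (simp add: field_simps)
    hence "ipoly_at S z \<in> \<rat>" by simp
    with algebraic_int_ipoly_at_root_of_unity[OF z n, of S]
    have "ipoly_at S z \<in> \<int>" by (rule rational_algebraic_int_is_int)
    then obtain s where "ipoly_at S z = of_int s" by (elim Ints_cases)
    hence "of_int a = (of_int (int r * s) :: complex)" using eq by simp
    hence "a = int r * s" by (simp only: of_int_eq_iff)
    thus ?thesis by (simp add: abs_mult nat_mult_distrib)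
  qed
  thus ?thesis using a0 by (intro exI[of _ "nat \<bar>a\<bar>"]) auto
qed


section \<open>Invariance under conjugation\<close>

lemma ipoly_at_pcompose_monom:
  "ipoly_at (pcompose f (monom 1 m)) z = ipoly_at f (z ^ m)"
  by (simp add: of_int_hom.map_poly_pcompose poly_pcompose poly_monom)

text \<open>
  Take for \<open>t\<close> the product of the primes that divide \<open>N\<close> but not \<open>k\<close>: since \<open>k\<close> and \<open>n\<close> are
  coprime, each prime divisor of \<open>N\<close> then divides exactly one of \<open>k\<close> and \<open>n t\<close>.
\<close>

lemma coprime_shift_exists:
  fixes k n N :: nat
  assumes "coprime k n" "n > 0" "N > 0"
  shows "\<exists>t>0. coprime (k + n * t) N"
proof -
  define T where "T = {r. prime r \<and> r dvd N \<and> \<not> r dvd k}"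
  have finT: "finite T"
    by (rule finite_subset[of _ "{..N}"]) (use assms in \<open>auto simp: T_def dest: dvd_imp_le\<close>)
  define t where "t = \<Prod>T"
  have t0: "t > 0" unfolding t_def by (rule prod_pos) (auto simp: T_def prime_gt_0_nat)
  have "\<not> (r dvd k + n * t \<and> r dvd N)" if r: "prime r" for r
  proof (intro notI, elim conjE)
    assume d: "r dvd k + n * t" and N: "r dvd N"
    show False
    proof (cases "r dvd k")
      case True
      hence "r dvd n * t" using d by (simp add: dvd_add_right_iff)
      moreover have "\<not> r dvd n" using True assms(1) r by (metis coprime_def not_prime_unit)
      ultimately have "r dvd t" using r by (simp add: prime_dvd_mult_iff)
      then obtain s where "s \<in> T" "r dvd s"
        unfolding t_def using prime_dvd_prod_iff[OF finT r, of id] by auto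
      hence "r = s" "\<not> s dvd k" using r by (auto simp: T_def primes_dvd_imp_eq)
      thus False using True by simp
    next
      case False
      hence "r \<in> T" using r N by (simp add: T_def)
      hence "r dvd t" unfolding t_def using dvd_prodI[OF finT, of r "\<lambda>x. x"] by simp
      thus False using d False by (metis dvd_add_left_iff dvd_mult)
    qed
  qed
  hence "gcd (k + n * t) N = 1"
    by (metis prime_factor_nat gcd_greatest_iff)
  hence "coprime (k + n * t) N" by (simp add: coprime_iff_gcd_eq_1)
  with t0 show ?thesis by blast
qed

text \<open>
  This is how irreducibility of cyclotomic polynomials is used below. The constant \<open>B\<close> in the
  proof collects the prime divisors of all nonzero values \<open>f(z ^ i)\<close> at once, so that the step from
  \<open>z ^ m\<close> to \<open>z ^ (m r)\<close> is possible for every prime \<open>r\<close> not dividing \<open>B\<close> and can be iterated over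
  the prime factors of an exponent coprime to \<open>B\<close>.
\<close>

lemma ipoly_at_conjugate_root_of_unity:
  assumes z: "z ^ n = 1" and n: "n > 0" and root: "ipoly_at f z = 0" and k: "coprime k n"
  shows "ipoly_at f (z ^ k) = 0"
proof -
  have "\<exists>N>0. ipoly_at f (z ^ i) \<noteq> 0 \<longrightarrow>
      (\<forall>r h. prime r \<longrightarrow> ipoly_at f (z ^ i) = of_nat r * ipoly_at h z \<longrightarrow> r dvd (N :: nat))" for i
  proof (cases "ipoly_at f (z ^ i) = 0")
    case False
    thus ?thesis
      using finite_prime_divisors_cyclotomic_integer[OF z n, of "pcompose f (monom 1 i)"]
      by (simp add: ipoly_at_pcompose_monom)
  qed auto
  then obtain N :: "nat \<Rightarrow> nat" where N: "\<And>i. N i > 0"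
    "\<And>i r h. ipoly_at f (z ^ i) \<noteq> 0 \<Longrightarrow> prime r \<Longrightarrow>
       ipoly_at f (z ^ i) = of_nat r * ipoly_at h z \<Longrightarrow> r dvd N i"
    by metis
  define B where "B = (\<Prod>i<n. N i)"
  have B0: "B > 0" unfolding B_def using N(1) by (simp add: prod_pos)
  have step: "ipoly_at f (z ^ (m * r)) = 0"
    if m: "ipoly_at f (z ^ m) = 0" and r: "prime r" "\<not> r dvd B" for m r
  proof (rule ccontr)
    assume nz: "ipoly_at f (z ^ (m * r)) \<noteq> 0"
    obtain h where h: "pcompose f (monom 1 r) - f ^ r = of_nat r * h"
      using prime_dvd_pcompose_monom_minus_power[OF r(1), of f] by (elim dvdE)
    have "ipoly_at (pcompose f (monom 1 r)) (z ^ m) = ipoly_at (f ^ r + of_nat r * h) (z ^ m)"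
      by (simp flip: h)
    also have "\<dots> = of_nat r * ipoly_at h (z ^ m)"
      using m r(1) by (simp add: of_int_poly_hom.hom_add of_int_poly_hom.hom_mult
          of_int_poly_hom.hom_power
          of_int_poly_hom.hom_of_nat power_0_left del: of_nat_poly)
    finally have "ipoly_at f (z ^ (m * r)) = of_nat r * ipoly_at (pcompose h (monom 1 m)) z"
      by (simp add: ipoly_at_pcompose_monom power_mult)
    moreover have "z ^ (m * r) = z ^ ((m * r) mod n)" by (rule power_mod_of_root_of_unity[OF z])
    ultimately have "r dvd N ((m * r) mod n)" using N(2) nz r(1) by metis
    also have "\<dots> dvd B" unfolding B_def using n by (intro dvd_prodI) auto
    finally show False using r(2) by simp
  qed
  have "coprime l B \<Longrightarrow> l > 0 \<Longrightarrow> ipoly_at f (z ^ m) = 0 \<Longrightarrow> ipoly_at f (z ^ (m * l)) = 0" for l m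
  proof (induction l arbitrary: m rule: prime_divisors_induct)
    case (unit l)
    thus ?case by simp
  next
    case (factor r l)
    have "\<not> r dvd B" using factor by (metis coprime_def dvd_triv_left not_prime_unit)
    hence "ipoly_at f (z ^ (m * r)) = 0" using factor step by blast
    moreover have "coprime l B" "l > 0" using factor by auto
    ultimately show ?case using factor.IH[of "m * r"] by (simp add: mult.assoc)
  qed auto
  note iter = this
  \<comment> \<open>Shifting \<open>k\<close> by a multiple of \<open>n\<close> leaves \<open>z ^ k\<close> unchanged; \<open>t > 0\<close> keeps the exponent positive
    even if \<open>k = 0\<close>, which can happen for \<open>n = 1\<close>.\<close>
  obtain t where t: "t > 0" "coprime (k + n * t) B"
    using coprime_shift_exists[OF k n B0] by blast
  have "ipoly_at f (z ^ (1 * (k + n * t))) = 0"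
    using t n root by (intro iter) auto
  also have "z ^ (1 * (k + n * t)) = z ^ k" using z by (simp add: power_add power_mult)
  finally show ?thesis .
qed

section \<open>Roots of unity and the degree of a polynomial\<close>

lemma inj_on_power_primitive_root:
  fixes z :: complex
  assumes z: "z ^ n = 1" and prim: "\<And>m. 0 < m \<Longrightarrow> m < n \<Longrightarrow> z ^ m \<noteq> 1"
  shows "inj_on (\<lambda>k. z ^ k) {0<..n}"
proof (rule linorder_inj_onI)
  fix j k assume jk: "j < k" "j \<in> {0<..n}" "k \<in> {0<..n}"
  have "z \<noteq> 0" using z jk by (auto simp: power_0_left)
  moreover have "z ^ k = z ^ j * z ^ (k - j)" using jk by (simp flip: power_add)
  moreover have "z ^ (k - j) \<noteq> 1" using jk by (intro prim) auto
  ultimately show "z ^ j \<noteq> z ^ k" by auto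
qed auto

lemma totient_le_degree_of_primitive_root:
  assumes z: "z ^ n = 1" and n: "n > 0" and prim: "\<And>m. 0 < m \<Longrightarrow> m < n \<Longrightarrow> z ^ m \<noteq> 1"
    and root: "ipoly_at f z = 0" and f: "f \<noteq> 0"
  shows "totient n \<le> degree f"
proof -
  let ?F = "of_int_poly f :: complex poly"
  have F: "?F \<noteq> 0" using f by simp
  have "totient n = card ((\<lambda>k. z ^ k) ` totatives n)"
    unfolding totient_def
    by (intro card_image[symmetric] inj_on_subset[OF inj_on_power_primitive_root[OF z prim]] totatives_subset)
  also have "\<dots> \<le> card {x. poly ?F x = 0}"
    using ipoly_at_conjugate_root_of_unity[OF z n root]
    by (intro card_mono poly_roots_finite F) (auto simp: in_totatives_iff)
  also have "\<dots> \<le> degree ?F" by (rule card_poly_roots_bound[OF F])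
  finally show ?thesis by simp
qed

section \<open>Polynomials of degree less than \<open>p q\<close>\<close>

text \<open>
  If \<open>q\<^sup>2\<close> divides \<open>n\<close>, the factor \<open>q (q - 1) \<ge> p q\<close> of \<open>totient n\<close> suffices. This leaves
  \<open>n = p\<^sup>2 q\<close> with \<open>totient n = p (p - 1) (q - 1)\<close>, where \<open>(p - 1) (q - 1) \<ge> q\<close> fails only for
  \<open>p = 2\<close>.
\<close>

lemma totient_large_divisor_of_square:
  fixes p q n :: nat
  assumes p: "prime p" and q: "prime q" and pq: "p < q"
    and n: "n dvd (p * q)\<^sup>2" "p * q < n"
  shows "p * q \<le> totient n \<or> p = 2 \<and> n = 4 * q"
proof -
  obtain a b where ab: "n = p ^ a * q ^ b" "a \<le> 2" "b \<le> 2"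
  proof -
    from n(1) have "n dvd p\<^sup>2 * q\<^sup>2" by (simp add: power_mult_distrib)
    then obtain x y where "n = x * y" "x dvd p\<^sup>2" "y dvd q\<^sup>2" using division_decomp by blast
    thus ?thesis using that p q by (metis divides_primepow_nat)
  qed
  have cop: "coprime (p ^ i) (q ^ j)" for i j
    using p q pq by (auto simp: primes_coprime)
  have p2: "p \<ge> 2" and q3: "q \<ge> 3" using p pq prime_ge_2_nat[OF p] by auto
  have tp: "totient p = p - 1" "totient (p\<^sup>2) = p * (p - 1)" 
    and tq: "totient q = q - 1" "totient (q\<^sup>2) = q * (q - 1)"
    using p q totient_prime_power[of p 2] totient_prime_power[of q 2] by (auto simp: totient_prime)
  have qq: "p * q \<le> q * (q - 1)" using pq by (simp add: mult.commute)
  have tn: "totient n = totient (p ^ a) * totient (q ^ b)"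
    unfolding ab by (rule totient_mult_coprime[OF cop])
  consider "a \<le> 1" "b \<le> 1" | "a = 2" "b = 0" | "b = 2" | "a = 2" "b = 1"
    using ab by linarith
  thus ?thesis
  proof cases
    case 1
    have "p ^ a \<le> p ^ 1" "q ^ b \<le> q ^ 1" using 1 p2 q3 by (intro power_increasing; simp)+
    hence "n \<le> p * q" unfolding ab using mult_le_mono by simp
    thus ?thesis using n by simp
  next
    case 2
    hence "n \<le> p * q" using ab pq by (simp add: power2_eq_square)
    thus ?thesis using n by simp
  next
    case 3
    have "1 \<le> totient (p ^ a)" using p2 by (simp add: Suc_le_eq)
    hence "1 * (q * (q - 1)) \<le> totient (p ^ a) * totient (q ^ b)"
      using 3 tq by (intro mult_le_mono) auto
    thus ?thesis using qq tn by linarith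
  next
    case 4
    show ?thesis
    proof (cases "p = 2")
      case True
      thus ?thesis using ab 4 by simp
    next
      case False
      have "q \<le> 2 * (q - 1)" using q3 by simp
      also have "\<dots> \<le> (p - 1) * (q - 1)" using False p2 by (intro mult_right_mono) auto
      finally have "p * q \<le> p * ((p - 1) * (q - 1))" by simp
      thus ?thesis using tn tp tq 4 by (simp add: mult.assoc)
    qed
  qed
qed


text \<open>
  Since the \<open>4 q\<close>-th cyclotomic polynomial times \<open>X\<^sup>2 + 1\<close> is \<open>X ^ (2 q) + 1\<close>, the product
  \<open>g = (X\<^sup>2 + 1) f\<close> vanishes at all \<open>2 q\<close> roots of \<open>X ^ (2 q) + 1\<close>. Its degree is at most
  \<open>2 q + 1\<close>, so \<open>g = (\<alpha> + \<beta> X) (X ^ (2 q) + 1)\<close>, where \<open>\<alpha>\<close> and \<open>\<beta>\<close> are the coefficients of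
  \<open>f\<close> in degrees \<open>2 q - 2\<close> and \<open>2 q - 1\<close>. For \<open>q \<ge> 3\<close> the coefficients of \<open>X\<^sup>2\<close> and \<open>X\<^sup>3\<close> on the right are zero, and nonnegativity
  forces \<open>f\<close> to have zero coefficients in degrees \<open>0\<close> to \<open>3\<close>.
\<close>

lemma nonneg_poly_at_primitive_root_4q_eq_0:
  fixes f :: "int poly"
  assumes q: "prime q" "q \<ge> 3"
    and z: "z ^ (4 * q) = 1" and prim: "\<And>m. 0 < m \<Longrightarrow> m < 4 * q \<Longrightarrow> z ^ m \<noteq> 1"
    and root: "ipoly_at f z = 0" and deg: "degree f < 2 * q" and nonneg: "\<And>i. coeff f i \<ge> 0"
  shows "f = 0"
proof -
  define \<alpha> where "\<alpha> = coeff f (2 * q - 2)"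
  define \<beta> where "\<beta> = coeff f (2 * q - 1)"
  define g where "g = f + monom 1 2 * f"
  define h where "h = g - [:\<alpha>, \<beta>:] - monom 1 (2 * q) * [:\<alpha>, \<beta>:]"
  have f0: "coeff f i = 0" if "i \<ge> 2 * q" for i using that deg by (intro coeff_eq_0) simp
  have coeff_g: "coeff g i = coeff f i + (if i < 2 then 0 else coeff f (i - 2))" for i
    by (simp add: g_def coeff_monom_mult)
  have coeff_ab: "coeff [:\<alpha>, \<beta>:] i = (if i = 0 then \<alpha> else if i = 1 then \<beta> else 0)" for i
    by (auto simp: coeff_pCons split: nat.splits)
  have coeff_h: "coeff h i = coeff g i - coeff [:\<alpha>, \<beta>:] i
      - (if i < 2 * q then 0 else coeff [:\<alpha>, \<beta>:] (i - 2 * q))" for i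
    unfolding h_def coeff_diff coeff_monom_mult by simp
  have "coeff h i = 0" if i: "i \<ge> 2 * q" for i
  proof -
    consider "i = 2 * q" | "i = 2 * q + 1" | "i \<ge> 2 * q + 2" using i by linarith
    thus ?thesis
      unfolding coeff_h coeff_g coeff_ab using q
      by cases (auto simp: f0 \<alpha>_def \<beta>_def)
  qed
  hence deg_h: "h = 0 \<or> degree h < 2 * q" by (metis leading_coeff_0_iff not_le)
  have half: "z ^ (2 * q) = -1"
  proof -
    have "(z ^ (2 * q)) ^ 2 = 1" using z by (simp flip: power_mult add: mult.commute)
    moreover have "z ^ (2 * q) \<noteq> 1" using q by (intro prim) auto
    ultimately show ?thesis by (simp add: power2_eq_1_iff)
  qed
  have h_root: "ipoly_at h (z ^ (2 * j + 1)) = 0" if j: "j < 2 * q" for j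
  proof -
    let ?k = "2 * j + 1" and ?w = "z ^ (2 * j + 1)"
    have w: "?w ^ (2 * q) = -1"
    proof -
      have "?w ^ (2 * q) = (z ^ (2 * q)) ^ ?k" by (simp only: mult.commute flip: power_mult)
      thus ?thesis by (simp add: half)
    qed
    have "ipoly_at g ?w = 0"
      \<comment> \<open>The odd powers of \<open>z\<close> with exponent divisible by \<open>q\<close> are the roots of \<open>X\<^sup>2 + 1\<close>; the others are
        the conjugates of \<open>z\<close>.\<close>
    proof (cases "q dvd ?k")
      case True
      then obtain s where s: "?k = q * s" by blast
      hence "odd s" by (metis even_mult_iff odd_two_times_div_two_succ dvd_triv_left even_plus_one_iff)
      have "?k * 2 = 2 * q * s" unfolding s by simp
      hence "?w ^ 2 = z ^ (2 * q * s)" by (metis power_mult)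
      also have "\<dots> = (z ^ (2 * q)) ^ s" by (rule power_mult)
      also have "\<dots> = -1" using \<open>odd s\<close> by (simp add: half)
      finally show ?thesis
        by (simp add: g_def of_int_poly_hom.hom_add of_int_poly_hom.hom_mult poly_monom)
    next
      case False
      hence "coprime ?k q" using q(1) by (metis coprime_commute prime_imp_coprime)
      moreover have "coprime ?k (2 ^ 2)" by (intro coprime_power_right_iff[THEN iffD2]) simp
      ultimately have "coprime ?k (4 * q)" by simp
      hence "ipoly_at f ?w = 0" using q root
        by (intro ipoly_at_conjugate_root_of_unity[OF z]) auto
      thus ?thesis by (simp add: g_def of_int_poly_hom.hom_add of_int_poly_hom.hom_mult)
    qed
    moreover have "ipoly_at (monom 1 (2 * q)) ?w = -1" using w by (simp add: poly_monom)
    moreover have "ipoly_at h ?w = ipoly_at g ?w - ipoly_at [:\<alpha>, \<beta>:] ?w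
        - ipoly_at (monom 1 (2 * q)) ?w * ipoly_at [:\<alpha>, \<beta>:] ?w"
      unfolding h_def
      by (simp only: of_int_poly_hom.hom_minus of_int_poly_hom.hom_mult poly_diff poly_mult)
    ultimately show ?thesis by simp
  qed
  have "h = 0"
  proof (rule ccontr)
    assume h: "h \<noteq> 0"
    let ?H = "of_int_poly h :: complex poly"
    have H: "?H \<noteq> 0" using h by simp
    have "inj_on (\<lambda>j. z ^ (2 * j + 1)) {..<2 * q}"
    proof (rule inj_onI)
      fix x y assume "x \<in> {..<2 * q}" "y \<in> {..<2 * q}" "z ^ (2 * x + 1) = z ^ (2 * y + 1)"
      hence "2 * x + 1 = 2 * y + 1"
        by (intro inj_onD[OF inj_on_power_primitive_root[OF z prim], of "2 * x + 1" "2 * y + 1"]) auto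
      thus "x = y" by simp
    qed
    hence "2 * q = card ((\<lambda>j. z ^ (2 * j + 1)) ` {..<2 * q})" by (simp add: card_image)
    also have "\<dots> \<le> card {x. poly ?H x = 0}"
      using h_root by (intro card_mono poly_roots_finite H) auto
    also have "\<dots> \<le> degree ?H" by (rule card_poly_roots_bound[OF H])
    finally show False using deg_h h by simp
  qed
  hence h0: "coeff h i = 0" for i by simp
  have "coeff f 0 = \<alpha>" "coeff f 1 = \<beta>" "coeff f 2 + coeff f 0 = 0" "coeff f 3 + coeff f 1 = 0"
    using h0[of 0] h0[of 1] h0[of 2] h0[of 3] q(2) unfolding coeff_h coeff_g coeff_ab by auto
  hence ab: "\<alpha> = 0" "\<beta> = 0" using nonneg[of 0] nonneg[of 1] nonneg[of 2] nonneg[of 3] by linarith+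
  have "[:1, 0, 1:] * f = 0"
  proof -
    have "[:1, 0, 1:] * f = g" by (simp add: g_def monom_altdef numeral_2_eq_2)
    also have "g = 0" using \<open>h = 0\<close> ab by (simp add: h_def)
    finally show ?thesis .
  qed
  moreover have "[:1, 0, 1:] \<noteq> (0 :: int poly)" by simp
  ultimately show ?thesis unfolding mult_eq_0_iff by blast
qed

section \<open>Frequencies with denominator \<open>M\<^sup>2\<close>\<close>

lemma nu_hat_nonzero:
  fixes p q :: nat and A :: "nat set" and d :: int
  assumes p: "prime p" and q: "prime q" and pq: "p < q"
    and A: "A \<subseteq> {..<p * q}" "A \<noteq> {}" and d: "d \<noteq> 0" "\<bar>d\<bar> < int (p * q)"
  shows "nu_hat (real ` A) (of_int d / (real (p * q))\<^sup>2) \<noteq> 0"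
proof
  assume zero: "nu_hat (real ` A) (of_int d / (real (p * q))\<^sup>2) = 0"
  define M where "M = p * q"
  have M0: "M > 0" using p q by (simp add: M_def prime_gt_0_nat)
  have finA: "finite A" using A finite_subset by blast
  define z where "z = exp (- 2 * of_real pi * \<i> * of_real (of_int d / (real M)\<^sup>2))"
  define f where "f = (\<Sum>a\<in>A. monom (1::int) a)"
  have coeff_f: "coeff f i = (if i \<in> A then 1 else 0)" for i
    using finA by (simp add: f_def coeff_sum)
  have f_nz: "f \<noteq> 0"
  proof -
    obtain a where "a \<in> A" using A by blast
    hence "coeff f a = 1" by (simp add: coeff_f)
    thus ?thesis by auto
  qed
  have deg: "degree f < p * q"
  proof -
    have "coeff f (degree f) \<noteq> 0" using f_nz by simp
    hence "degree f \<in> A" by (simp add: coeff_f split: if_splits)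
    thus ?thesis using A by auto
  qed
  have root: "ipoly_at f z = 0"
  proof -
    have "nu_hat (real ` A) (of_int d / (real M)\<^sup>2) =
        1 / of_nat (card A) * (\<Sum>a\<in>A. z ^ a)"
      unfolding nu_hat_def z_def
      by (simp add: card_image sum.reindex flip: exp_of_nat_mult) (simp add: algebra_simps)
    hence "(\<Sum>a\<in>A. z ^ a) = 0" using zero A(2) finA by (simp add: M_def)
    moreover have "ipoly_at f z = (\<Sum>a\<in>A. z ^ a)"
      by (simp add: f_def of_int_poly_hom.hom_sum poly_sum poly_monom)
    ultimately show ?thesis by simp
  qed
  have z_eq_1: "z ^ m = 1 \<longleftrightarrow> int (M\<^sup>2) dvd int m * d" for m
  proof -
    define x where "x = - 2 * pi * (real m * of_int d / (real M)\<^sup>2)"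
    have "z ^ m = cis x"
      by (simp add: z_def cis_conv_exp x_def flip: exp_of_nat_mult) (simp add: algebra_simps)
    hence "z ^ m = 1 \<longleftrightarrow> cos x = 1" by (auto simp: complex_eq_iff cos_one_sin_zero)
    hence "z ^ m = 1 \<longleftrightarrow> (\<exists>k::int. x = of_int k * 2 * pi)" by (simp add: cos_one_2pi_int)
    also have "\<dots> \<longleftrightarrow> (\<exists>k::int. real m * of_int d = (real M)\<^sup>2 * of_int (- k))"
      
    proof (intro ex_cong1)
      fix k :: int
      have "x = of_int k * 2 * pi \<longleftrightarrow> 2 * pi * (real m * of_int d / (real M)\<^sup>2 + of_int k) = 0"
        by (auto simp: x_def algebra_simps)
      also have "\<dots> \<longleftrightarrow> real m * of_int d / (real M)\<^sup>2 + of_int k = 0" by simp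
      also have "\<dots> \<longleftrightarrow> real m * of_int d = (real M)\<^sup>2 * of_int (- k)"
        using M0 by (auto simp: field_simps add_eq_0_iff)
      finally show "x = of_int k * 2 * pi \<longleftrightarrow> real m * of_int d = (real M)\<^sup>2 * of_int (- k)" .
    qed
    also have "\<dots> \<longleftrightarrow> (\<exists>k::int. int m * d = int (M\<^sup>2) * (- k))"
    proof (intro ex_cong1)
      fix k :: int
      have "(real m * of_int d = (real M)\<^sup>2 * of_int (- k)) \<longleftrightarrow>
          real_of_int (int m * d) = real_of_int (int (M\<^sup>2) * (- k))" by simp
      thus "(real m * of_int d = (real M)\<^sup>2 * of_int (- k)) \<longleftrightarrow> int m * d = int (M\<^sup>2) * (- k)"
        by (simp only: of_int_eq_iff)
    qed
    also have "\<dots> \<longleftrightarrow> int (M\<^sup>2) dvd int m * d"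
      by (metis add.inverse_inverse dvd_def)
    finally show ?thesis .
  qed
  define n where "n = (LEAST n. n > 0 \<and> z ^ n = 1)"
  have zM: "z ^ (M\<^sup>2) = 1" by (simp add: z_eq_1)
  hence "M\<^sup>2 > 0 \<and> z ^ (M\<^sup>2) = 1" using M0 by simp
  from LeastI[of "\<lambda>n. n > 0 \<and> z ^ n = 1", OF this] have n: "n > 0" "z ^ n = 1"
    by (simp_all add: n_def)
  have prim: "z ^ m \<noteq> 1" if "0 < m" "m < n" for m
    using that not_less_Least[of m "\<lambda>n. n > 0 \<and> z ^ n = 1"] by (auto simp: n_def)
  have "n dvd M\<^sup>2"
  proof -
    have "z ^ (M\<^sup>2 mod n) = 1"
      using zM power_mod_of_root_of_unity[OF n(2)] by metis
    hence "M\<^sup>2 mod n = 0" using prim[of "M\<^sup>2 mod n"] n(1) by auto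
    thus ?thesis by auto
  qed
  moreover have "M < n"
  proof -
    \<comment> \<open>\<open>M\<^sup>2\<close> divides the nonzero integer \<open>n d\<close>, whose absolute value is less than \<open>n M\<close>.\<close>
    have "int (M\<^sup>2) dvd int n * d" using n z_eq_1 by blast
    hence "int (M\<^sup>2) \<le> \<bar>int n * d\<bar>" 
      using dvd_imp_le_int[of "int n * d" "int (M\<^sup>2)"] n d by simp
    also have "\<dots> = int n * \<bar>d\<bar>" by (simp add: abs_mult)
    also have "\<dots> < int n * int M" using d n by (intro mult_strict_left_mono) (auto simp: M_def)
    finally have "int M * int M < int n * int M" by (simp add: power2_eq_square)
    thus ?thesis using M0 by (simp add: mult_less_cancel_right)
  qed
  ultimately consider "p * q \<le> totient n" | "p = 2" "n = 4 * q"
    using totient_large_divisor_of_square[OF p q pq, of n] by (auto simp: M_def)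
  thus False
  proof cases
    case 1
    thus False using totient_le_degree_of_primitive_root[OF n(2,1) prim root f_nz] deg by simp
  next
    case 2
    have "f = 0"
    proof (rule nonneg_poly_at_primitive_root_4q_eq_0[OF q])
      show "q \<ge> 3" using 2 pq by simp
      show "z ^ (4 * q) = 1" using 2 n by simp
      show "z ^ m \<noteq> 1" if "0 < m" "m < 4 * q" for m using prim that 2 by simp
      show "degree f < 2 * q" using deg 2 by simp
    qed (use root in \<open>auto simp: coeff_f\<close>)
    thus False using f_nz by simp
  qed
qed

section \<open>Orthogonality of columns and unitarity\<close>

text \<open>
  The Gram matrix of the columns has the values of \<open>nu_hat\<close> at the differences of elements of \<open>B\<close>
  as its entries. As the matrix is square, a left inverse is also a right inverse.
\<close>

lemma unitary_spectral_matrix_if_orthogonal: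
  assumes fin: "finite A" "finite B" and card: "card A = card B" "card A > 0"
    and orth: "\<And>b b'. b \<in> B \<Longrightarrow> b' \<in> B \<Longrightarrow> b \<noteq> b' \<Longrightarrow>
      nu_hat (real ` A) ((real b - real b') / real M) = 0"
  shows "unitary_mat (spectral_matrix M A B)"
proof -
  define n where "n = card A"
  define xs where "xs = sorted_list_of_set A"
  define ys where "ys = sorted_list_of_set B"
  define U where "U = spectral_matrix M A B"
  have xs: "set xs = A" "distinct xs" "length xs = n" using fin by (auto simp: xs_def n_def)
  have ys: "set ys = B" "distinct ys" "length ys = n" using fin card by (auto simp: ys_def n_def)
  have U: "U \<in> carrier_mat n n" using card by (simp add: U_def spectral_matrix_def n_def)
  have V: "mat_adjoint U \<in> carrier_mat n n"
    using U by (auto simp: mat_adjoint_def mat_of_rows_def)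
  have entry: "(mat_adjoint U * U) $$ (i, j) =
      nu_hat (real ` A) ((real (ys ! i) - real (ys ! j)) / real M)" if ij: "i < n" "j < n" for i j
  proof -
    have e: "U $$ (k, l) = 1 / of_real (sqrt (real n)) *
        exp (2 * of_real pi * \<i> * of_nat (xs ! k) * of_nat (ys ! l) / of_nat M)"
      if "k < n" "l < n" for k l
      using that card by (simp add: U_def spectral_matrix_def n_def xs_def ys_def)
    have "(mat_adjoint U * U) $$ (i, j) = (\<Sum>k<n. cnj (U $$ (k, i)) * U $$ (k, j))"
      using ij U V by (simp add: scalar_prod_def mat_adjoint_def mat_of_rows_def atLeast0LessThan)
    also have "\<dots> = (\<Sum>k<n. 1 / of_nat n *
        exp (- 2 * of_real pi * \<i> * of_real ((real (ys ! i) - real (ys ! j)) / real M) * of_real (real (xs ! k))))"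
    proof (intro sum.cong refl)
      fix k assume "k \<in> {..<n}"
      hence k: "k < n" by simp
      have s: "1 / complex_of_real (sqrt (real n)) * (1 / complex_of_real (sqrt (real n))) = 1 / of_nat n"
        by (simp flip: of_real_mult)
      have c: "exp (2 * of_real pi * \<i> * of_nat a * of_nat b / of_nat M) =
          cis (2 * pi * real a * real b / real M)" for a b
        by (simp add: cis_conv_exp ac_simps)
      have "cnj (U $$ (k, i)) * U $$ (k, j) =
          (1 / complex_of_real (sqrt (real n)) * (1 / complex_of_real (sqrt (real n)))) *
          (cis (- (2 * pi * real (xs ! k) * real (ys ! i) / real M)) *
           cis (2 * pi * real (xs ! k) * real (ys ! j) / real M))"
        using k ij by (simp add: e c cis_cnj)
      also have "\<dots> = 1 / of_nat n *
          cis (- 2 * pi * ((real (ys ! i) - real (ys ! j)) / real M) * real (xs ! k))"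
        unfolding s cis_mult by (simp add: algebra_simps diff_divide_distrib)
      also have "\<dots> = 1 / of_nat n * exp (- 2 * of_real pi * \<i> *
          of_real ((real (ys ! i) - real (ys ! j)) / real M) * of_real (real (xs ! k)))"
        by (simp add: cis_conv_exp ac_simps)
      finally show "cnj (U $$ (k, i)) * U $$ (k, j) = \<dots>" .
    qed
    also have "\<dots> = (\<Sum>a\<in>A. 1 / of_nat n *
        exp (- 2 * of_real pi * \<i> * of_real ((real (ys ! i) - real (ys ! j)) / real M) * of_real (real a)))"
      by (rule sum.reindex_bij_betw[OF bij_betw_nth[OF xs(2)]]) (use xs in auto)
    also have "\<dots> = nu_hat (real ` A) ((real (ys ! i) - real (ys ! j)) / real M)"
      by (simp add: nu_hat_def card_image sum.reindex n_def sum_distrib_left)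
    finally show ?thesis .
  qed
  have VU: "mat_adjoint U * U = 1\<^sub>m n"
  proof (intro eq_matI)
    fix i j assume "i < dim_row (1\<^sub>m n :: complex mat)" "j < dim_col (1\<^sub>m n :: complex mat)"
    hence ij: "i < n" "j < n" by auto
    show "(mat_adjoint U * U) $$ (i, j) = 1\<^sub>m n $$ (i, j)"
    proof (cases "i = j")
      case True
      thus ?thesis using ij card by (simp add: entry nu_hat_def card_image)
    next
      case False
      hence "ys ! i \<noteq> ys ! j" using ij ys by (simp add: nth_eq_iff_index_eq)
      moreover have "ys ! i \<in> B" "ys ! j \<in> B" using ij ys by (metis nth_mem)+
      ultimately show ?thesis using ij False by (simp add: entry orth)
    qed
  qed (use U V in auto)
  have UV: "U * mat_adjoint U = 1\<^sub>m n" by (rule mat_mult_left_right_inverse[OF V U VU])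
  show ?thesis unfolding U_def[symmetric] unitary_mat_def inverts_mat_def
    using U V UV VU by auto
qed

theorem theorem4p3:
  fixes p q M :: nat and A B :: "nat set"
  assumes "prime p" and "prime q" and "p < q" and "M = p * q"
    and "A \<subseteq> {0..M - 1}" and "B \<subseteq> {0..M - 1}"
    and "1 < card A" and "card A = card B" and "card B < M"
    and "distributed_spectral_pair M A B"
  shows "spectral_pair M A B"
proof -
  have A: "A \<subseteq> {..<M}" and B: "B \<subseteq> {..<M}"
    and dist: "\<And>b1 b1'. b1 \<in> B \<Longrightarrow> b1' \<in> B \<Longrightarrow> b1 \<noteq> b1' \<Longrightarrow>
        nu_hat (real ` A) ((real b1 - real b1') / real M) = 0 \<or>
        (\<forall>b2\<in>B. \<forall>b2'\<in>B.
           nu_hat (real ` A)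
             ((real b1 - real b1') / (real M)\<^sup>2 + (real b2 - real b2') / real M) = 0)"
    using assms(10) by (auto simp: distributed_spectral_pair_def)
  \<comment> \<open>The choice \<open>b\<^sub>2 = b\<^sub>2'\<close> already makes the second alternative impossible.\<close>
  have orth: "nu_hat (real ` A) ((real b - real b') / real M) = 0"
    if b: "b \<in> B" "b' \<in> B" "b \<noteq> b'" for b b'
  proof (rule ccontr)
    assume "nu_hat (real ` A) ((real b - real b') / real M) \<noteq> 0"
    hence "nu_hat (real ` A) ((real b - real b') / (real M)\<^sup>2 + (real b - real b) / real M) = 0"
      using dist[OF b] b(1) by blast
    hence "nu_hat (real ` A) (of_int (int b - int b') / (real (p * q))\<^sup>2) = 0"
      using assms(4) by simp
    moreover have "\<bar>int b - int b'\<bar> < int (p * q)" 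
    proof -
      have "b < p * q" "b' < p * q" using b B assms(4) by auto
      hence "int b < int (p * q)" "int b' < int (p * q)" by (simp_all only: of_nat_less_iff)
      thus ?thesis by linarith
    qed
    moreover have "A \<noteq> {}" using assms(7) by auto
    ultimately show False
      using nu_hat_nonzero[OF assms(1-3), of A "int b - int b'"] A b assms(4) by auto
  qed
  have "finite A" "finite B" using A B finite_subset by blast+
  hence "unitary_mat (spectral_matrix M A B)"
    using assms(7,8) orth by (intro unitary_spectral_matrix_if_orthogonal) auto
  thus ?thesis using A B assms(8) by (simp add: spectral_pair_def)
qed

end
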